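(* Let $H$ be the graph consisting of a triangle together with one pendant edge (a fourth vertex joined to exactly one vertex of the triangle). Then $C(H,K_3)=\frac{3}{2}$.
   Context: All graphs are finite and simple. $\operatorname{hom}(H,T)$ is the number of maps $V(H)\to V(T)$ sending every edge of $H$ to an edge of $T$, $t(H,T)=\operatorname{hom}(H,T)/v(T)^{v(H)}$, and $C(G,H)=\min\{c\in\mathbb{R}: t(G,T)\geq t(H,T)^c \text{ for all graphs } T\}$. *)

theory Defs
  imports Complex_Main "HOL-Library.FuncSet" "Graph_Theory.Graph_Theory"
begin

text \<open>
  Finite simple graphs are represented by the predicate \<^const>\<open>pair_graph\<close>: a finite vertex set
  together with a symmetric, loop-free set of arcs between vertices, so that an edge
  \<open>{u, v}\<close> is the pair of arcs \<open>(u, v)\<close>, \<open>(v, u)\<close>.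
\<close>

definition graph_homs :: "'a pair_pre_digraph \<Rightarrow> 'b pair_pre_digraph \<Rightarrow> ('a \<Rightarrow> 'b) set" where
  "graph_homs H T =
     {f \<in> pverts H \<rightarrow>\<^sub>E pverts T. \<forall>u v. (u, v) \<in> parcs H \<longrightarrow> (f u, f v) \<in> parcs T}"

definition hom_count :: "'a pair_pre_digraph \<Rightarrow> 'b pair_pre_digraph \<Rightarrow> nat" where
  "hom_count H T = card (graph_homs H T)"

definition hom_density :: "'a pair_pre_digraph \<Rightarrow> 'b pair_pre_digraph \<Rightarrow> real" where
  "hom_density H T = real (hom_count H T) / real (card (pverts T)) ^ card (pverts H)"

text \<open>
  The target graphs have vertices of type \<^typ>\<open>nat\<close>; every finite graph is isomorphic to such a graph,
  and lemma \<open>dominating_exponents_any_type\<close> below gives the inequality for target graphs over an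
  arbitrary type. Targets are nonempty, since the density is a quotient by a power of the number of
  vertices. Note that \<open>0 powr c = 0\<close> for every real \<open>c\<close>.
\<close>

definition dominating_exponents :: "'a pair_pre_digraph \<Rightarrow> 'b pair_pre_digraph \<Rightarrow> real set" where
  "dominating_exponents G H =
     {c. \<forall>T :: nat pair_pre_digraph. pair_graph T \<and> pverts T \<noteq> {} \<longrightarrow>
           hom_density G T \<ge> hom_density H T powr c}"

definition domination_exponent :: "'a pair_pre_digraph \<Rightarrow> 'b pair_pre_digraph \<Rightarrow> real" where
  "domination_exponent G H = (LEAST c. c \<in> dominating_exponents G H)"

definition triangle_with_pendant_edge :: "'a pair_pre_digraph \<Rightarrow> bool" where
  "triangle_with_pendant_edge G \<longleftrightarrow>
     (\<exists>a b c d. distinct [a, b, c, d] \<and> pverts G = {a, b, c, d} \<and>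
        (let E = {(a, b), (b, c), (c, a), (a, d)} in parcs G = E \<union> E\<inverse>))"

lemma pair_graph_triangle_with_pendant_edge:
  assumes "triangle_with_pendant_edge G"
  shows "pair_graph G"
proof -
  obtain a b c d where d: "distinct [a, b, c, d]" and V: "pverts G = {a, b, c, d}"
    and E: "parcs G = {(a, b), (b, c), (c, a), (a, d)} \<union> {(a, b), (b, c), (c, a), (a, d)}\<inverse>"
    using assms unfolding triangle_with_pendant_edge_def Let_def by blast
  have "sym (parcs G)"
    unfolding E by (rule sym_Un_converse)
  then have "symmetric (with_proj G)"
    by (simp add: symmetric_def)
  moreover have "finite (parcs G)"
    unfolding E by (simp add: finite_converse)
  ultimately show ?thesis
    using d by unfold_locales (auto simp: V E)
qed

lemma ex_triangle_with_pendant_edge: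
  "\<exists>G :: nat pair_pre_digraph. triangle_with_pendant_edge G"
  unfolding triangle_with_pendant_edge_def Let_def
  by (rule exI[of _ "\<lparr>pverts = {0, 1, 2, 3},
        parcs = {(0, 1), (1, 2), (2, 0), (0, 3)} \<union> {(0, 1), (1, 2), (2, 0), (0, 3)}\<inverse>\<rparr>"],
      rule exI[of _ 0], rule exI[of _ 1], rule exI[of _ 2], rule exI[of _ 3]) simp

lemma hom_density_image:
  fixes T :: "'c pair_pre_digraph" and g :: "'c \<Rightarrow> 'd"
  assumes T: "pair_graph T" and H: "pair_graph H" and g: "inj_on g (pverts T)"
  defines "T' \<equiv> \<lparr>pverts = g ` pverts T, parcs = map_prod g g ` parcs T\<rparr>"
  shows "pair_graph T'" and "hom_density H T' = hom_density H T"
proof -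
  interpret T: pair_graph T by fact
  interpret H: pair_graph H by fact
  have arc: "(g u, g v) \<in> parcs T' \<longleftrightarrow> (u, v) \<in> parcs T" if "u \<in> pverts T" "v \<in> pverts T" for u v
  proof
    assume "(g u, g v) \<in> parcs T'"
    then obtain x y where xy: "(x, y) \<in> parcs T" "g u = g x" "g v = g y"
      unfolding T'_def by auto
    have "x \<in> pverts T" "y \<in> pverts T"
      using T.in_arcsD1[OF xy(1)] T.in_arcsD2[OF xy(1)] by simp_all
    then have "u = x" "v = y"
      using inj_onD[OF g xy(2)] inj_onD[OF g xy(3)] that by simp_all
    then show "(u, v) \<in> parcs T"
      using xy(1) by simp
  next
    assume "(u, v) \<in> parcs T"
    then show "(g u, g v) \<in> parcs T'"
      unfolding T'_def by force
  qed
  have "sym (parcs T)"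
    using T.pair_sym_arcs by (simp add: symmetric_def)
  then have "sym (parcs T')"
    unfolding T'_def sym_def by force
  then have "symmetric (with_proj T')"
    by (simp add: symmetric_def)
  moreover have "fst e \<in> pverts T'" "snd e \<in> pverts T'" "fst e \<noteq> snd e" if "e \<in> parcs T'" for e
  proof -
    obtain x y where xy: "(x, y) \<in> parcs T" "e = (g x, g y)"
      using \<open>e \<in> parcs T'\<close> unfolding T'_def by auto
    have V: "x \<in> pverts T" "y \<in> pverts T"
      using T.in_arcsD1[OF xy(1)] T.in_arcsD2[OF xy(1)] by simp_all
    then show "fst e \<in> pverts T'" "snd e \<in> pverts T'"
      by (simp_all add: T'_def xy(2))
    show "fst e \<noteq> snd e"
      using T.no_loops'[OF xy(1)] inj_onD[OF g _ V] by (auto simp: xy(2))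
  qed
  moreover have "finite (pverts T')" "finite (parcs T')"
    using T.pair_finite_verts T.pair_finite_arcs by (simp_all add: T'_def)
  ultimately show "pair_graph T'"
    by unfold_locales
  have "bij_betw (\<lambda>f. restrict (g \<circ> f) (pverts H)) (graph_homs H T) (graph_homs H T')"
  proof (rule bij_betw_byWitness[where f' = "\<lambda>f. restrict (inv_into (pverts T) g \<circ> f) (pverts H)"])
    show "\<forall>f\<in>graph_homs H T.
        restrict (inv_into (pverts T) g \<circ> restrict (g \<circ> f) (pverts H)) (pverts H) = f"
      using g by (auto simp: graph_homs_def PiE_iff extensional_def fun_eq_iff)
    show "\<forall>f\<in>graph_homs H T'.
        restrict (g \<circ> restrict (inv_into (pverts T) g \<circ> f) (pverts H)) (pverts H) = f"
      by (auto simp: graph_homs_def T'_def PiE_iff extensional_def fun_eq_iff f_inv_into_f)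
    show "(\<lambda>f. restrict (g \<circ> f) (pverts H)) ` graph_homs H T \<subseteq> graph_homs H T'"
    proof (rule image_subsetI)
      fix f assume f: "f \<in> graph_homs H T"
      then have V: "f u \<in> pverts T" if "u \<in> pverts H" for u
        using that by (auto simp: graph_homs_def)
      show "restrict (g \<circ> f) (pverts H) \<in> graph_homs H T'"
      proof -
        have "(g (f u), g (f v)) \<in> parcs T'" if uv: "(u, v) \<in> parcs H" for u v
          using f uv arc[OF V[OF H.in_arcsD1[OF uv]] V[OF H.in_arcsD2[OF uv]]]
          by (simp add: graph_homs_def)
        moreover have "g (f u) \<in> pverts T'" if "u \<in> pverts H" for u
          using V[OF that] by (simp add: T'_def)
        ultimately show ?thesis
          using H.in_arcsD1 H.in_arcsD2 by (simp add: graph_homs_def)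
      qed
    qed
    show "(\<lambda>f. restrict (inv_into (pverts T) g \<circ> f) (pverts H)) ` graph_homs H T'
        \<subseteq> graph_homs H T"
    proof (rule image_subsetI)
      fix f assume f: "f \<in> graph_homs H T'"
      then have V: "f u \<in> g ` pverts T" if "u \<in> pverts H" for u
        using that by (auto simp: graph_homs_def T'_def)
      have I: "inv_into (pverts T) g (f u) \<in> pverts T" "g (inv_into (pverts T) g (f u)) = f u"
        if "u \<in> pverts H" for u
        using V[OF that] by (auto intro: inv_into_into f_inv_into_f)
      have "(inv_into (pverts T) g (f u), inv_into (pverts T) g (f v)) \<in> parcs T"
        if "(u, v) \<in> parcs H" for u v
      proof -
        have uv: "u \<in> pverts H" "v \<in> pverts H"
          using H.in_arcsD1[OF that] H.in_arcsD2[OF that] by simp_all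
        have "(f u, f v) \<in> parcs T'"
          using f that by (simp add: graph_homs_def)
        then show ?thesis
          using arc[OF I(1)[OF uv(1)] I(1)[OF uv(2)]] I(2) uv by simp
      qed
      then show "restrict (inv_into (pverts T) g \<circ> f) (pverts H) \<in> graph_homs H T"
        using I(1) H.in_arcsD1 H.in_arcsD2 by (simp add: graph_homs_def)
    qed
  qed
  then have "hom_count H T' = hom_count H T"
    by (simp add: hom_count_def bij_betw_same_card)
  moreover have "card (pverts T') = card (pverts T)"
    using g by (simp add: T'_def card_image)
  ultimately show "hom_density H T' = hom_density H T"
    by (simp add: hom_density_def)
qed

lemma dominating_exponents_any_type:
  fixes T :: "'c pair_pre_digraph"
  assumes "pair_graph G" "pair_graph H" "c \<in> dominating_exponents G H"
    and "pair_graph T" "pverts T \<noteq> {}"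
  shows "hom_density G T \<ge> hom_density H T powr c"
proof -
  interpret T: pair_graph T by fact
  obtain g :: "'c \<Rightarrow> nat" where g: "inj_on g (pverts T)"
    using finite_imp_inj_to_nat_seg[OF T.pair_finite_verts] by blast
  define T' where "T' = \<lparr>pverts = g ` pverts T, parcs = map_prod g g ` parcs T\<rparr>"
  have "pair_graph T'" "pverts T' \<noteq> {}"
    using hom_density_image(1)[OF assms(4,1) g] assms(5) by (simp_all add: T'_def)
  then have "hom_density G T' \<ge> hom_density H T' powr c"
    using assms(3) by (simp add: dominating_exponents_def)
  then show ?thesis
    using hom_density_image(2)[OF assms(4,1) g] hom_density_image(2)[OF assms(4,2) g]
    by (simp add: T'_def)
qed

end

theory Submission
  imports Defs "HOL-Real_Asymp.Real_Asymp"
begin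

text \<open>
  Let \<open>d\<^sub>v\<close> be the degree of \<open>v\<close> and \<open>t\<^sub>v\<close> the number of ordered triangles based at \<open>v\<close>.
  Then \<open>hom(K\<^sub>3, T) = \<Sum>\<^sub>v t\<^sub>v\<close> and \<open>hom(H, T) = \<Sum>\<^sub>v t\<^sub>v d\<^sub>v\<close>. Since \<open>t\<^sub>v \<le> d\<^sub>v\<^sup>2\<close>, the power mean
  inequality with exponent 3/2 gives the upper bound. Disjoint unions of two large cliques
  of equal size have triangle density tending to 1/4 and \<open>H\<close>-density at most 1/8, so no
  smaller exponent is possible.
\<close>

text \<open>The pairs are ordered and the arcs run cyclically from \<open>v\<close> back to
  \<open>v\<close>, so these are the homomorphic images of a directed 3-cycle rooted at
  \<open>v\<close>.\<close>

definition triangles_at :: "'b pair_pre_digraph \<Rightarrow> 'b \<Rightarrow> ('b \<times> 'b) set" where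
  "triangles_at T v = {(x, y). (v, x) \<in> parcs T \<and> (x, y) \<in> parcs T \<and> (y, v) \<in> parcs T}"

definition nbrs :: "'b pair_pre_digraph \<Rightarrow> 'b \<Rightarrow> 'b set" where
  "nbrs T v = {w. (v, w) \<in> parcs T}"

context pair_graph
begin

lemma arc_sym: "(u, v) \<in> parcs G \<longleftrightarrow> (v, u) \<in> parcs G"
  using pair_sym_arcs by (auto simp: symmetric_def dest: symD)

lemma finite_nbrs [simp]: "finite (nbrs G v)"
  by (rule finite_subset[OF _ pair_finite_verts]) (auto simp: nbrs_def dest: in_arcsD2)

lemma triangles_at_subset: "triangles_at G v \<subseteq> nbrs G v \<times> nbrs G v"
  using arc_sym by (auto simp: triangles_at_def nbrs_def)

lemma finite_triangles_at [simp]: "finite (triangles_at G v)"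
  by (rule finite_subset[OF triangles_at_subset]) simp

text \<open>The only inequality about graphs behind the upper bound. Large cliques attain it up to
  lower order terms, which suggests them for the lower bound.\<close>

lemma card_triangles_at_le: "card (triangles_at G v) \<le> (card (nbrs G v))\<^sup>2"
  using card_mono[OF _ triangles_at_subset[of v]]
  by (simp add: card_cartesian_product power2_eq_square)

end

text \<open>Sort the homomorphisms by the image \<open>v\<close> of \<open>a\<close>; the images of
  \<open>b\<close> and \<open>c\<close> then range over \<open>triangles_at T v\<close>.\<close>

lemma hom_count_triangle:
  assumes "pair_graph T" and d: "distinct [a, b, c]" and V: "pverts K = {a, b, c}"
    and E: "parcs K = {(a, b), (b, c), (c, a)} \<union> {(a, b), (b, c), (c, a)}\<inverse>"
  shows "hom_count K T = (\<Sum>v\<in>pverts T. card (triangles_at T v))"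
proof -
  interpret T: pair_graph T by fact
  have "bij_betw (\<lambda>f. (f a, f b, f c)) (graph_homs K T) (SIGMA v:pverts T. triangles_at T v)"
    using d T.arc_sym T.in_arcsD1 T.in_arcsD2
    \<comment> \<open>The inverse starts from the constant \<open>undefined\<close> because
      homomorphisms are extensional functions.\<close>
    by (intro bij_betw_byWitness[where
          f' = "\<lambda>(u, x, y). (\<lambda>_. undefined)(a := u, b := x, c := y)"])
      (auto simp: graph_homs_def V E triangles_at_def PiE_iff extensional_def fun_eq_iff)
  then show ?thesis
    by (simp add: hom_count_def bij_betw_same_card T.pair_finite_verts)
qed

text \<open>Once the root is placed at \<open>v\<close>, the pendant vertex may go to any neighbour
  of \<open>v\<close>, even one on the image of the triangle, so the two choices are
  independent.\<close>

lemma hom_count_triangle_with_pendant_edge: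
  assumes "pair_graph T" and "triangle_with_pendant_edge H"
  shows "hom_count H T = (\<Sum>v\<in>pverts T. card (triangles_at T v) * card (nbrs T v))"
proof -
  interpret T: pair_graph T by fact
  obtain a b c d where d: "distinct [a, b, c, d]" and V: "pverts H = {a, b, c, d}"
    and E: "parcs H = {(a, b), (b, c), (c, a), (a, d)} \<union> {(a, b), (b, c), (c, a), (a, d)}\<inverse>"
    using assms(2) unfolding triangle_with_pendant_edge_def Let_def by blast
  have "bij_betw (\<lambda>f. (f a, (f b, f c), f d)) (graph_homs H T)
      (SIGMA v:pverts T. triangles_at T v \<times> nbrs T v)"
    using d T.arc_sym T.in_arcsD1 T.in_arcsD2
    by (intro bij_betw_byWitness[where
          f' = "\<lambda>(u, (x, y), w). (\<lambda>_. undefined)(a := u, b := x, c := y, d := w)"])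
      (auto simp: graph_homs_def V E triangles_at_def nbrs_def PiE_iff extensional_def fun_eq_iff)
  then show ?thesis
    by (simp add: hom_count_def bij_betw_same_card T.pair_finite_verts card_cartesian_product)
qed

lemma complete_digraph_3_triangle:
  assumes "complete_digraph 3 (with_proj K)"
  obtains a b c where "distinct [a, b, c]" "pverts K = {a, b, c}"
    "parcs K = {(a, b), (b, c), (c, a)} \<union> {(a, b), (b, c), (c, a)}\<inverse>"
proof -
  have "card (pverts K) = 3" and E: "parcs K = {(u, v). u \<in> pverts K \<and> v \<in> pverts K \<and> u \<noteq> v}"
    using assms by (auto simp: complete_digraph_pair_def)
  then obtain a b c where "distinct [a, b, c]" "pverts K = {a, b, c}"
    by (auto simp: card_3_iff)
  moreover from this have "parcs K = {(a, b), (b, c), (c, a)} \<union> {(a, b), (b, c), (c, a)}\<inverse>"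
    by (auto simp: E)
  ultimately show ?thesis by (rule that)
qed

text \<open>The power mean inequality, from the tangent line of \<open>s \<mapsto> s\<^sup>3\<close> in the variable \<open>s\<^sup>2\<close>
  at the mean value.\<close>

lemma sum_mult_sqrt_ge:
  fixes t :: "'b \<Rightarrow> real"
  assumes V: "finite V" "V \<noteq> {}" and t: "\<And>v. v \<in> V \<Longrightarrow> t v \<ge> 0"
  shows "sum t V * sqrt (sum t V / card V) \<le> (\<Sum>v\<in>V. t v * sqrt (t v))"
proof -
  define m where "m = sqrt (sum t V / card V)"
  have m: "m \<ge> 0" and m2: "card V * m\<^sup>2 = sum t V"
    using V t by (simp_all add: m_def sum_nonneg)
  have tangent: "3 / 2 * m * t v - m ^ 3 / 2 \<le> t v * sqrt (t v)" if "v \<in> V" for v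
  proof -
    define s where "s = sqrt (t v)"
    have s: "s \<ge> 0" "t v = s\<^sup>2"
      using t[OF that] by (simp_all add: s_def)
    \<comment> \<open>The product expands to 2 s^3 - 3 m s^2 + m^3, twice the gap between the cube
      and its tangent.\<close>
    have "0 \<le> (s - m)\<^sup>2 * (2 * s + m)"
      using s(1) m by simp
    then show ?thesis
      using s(1) by (simp add: s(2) power2_eq_square power3_eq_cube algebra_simps)
  qed
  \<comment> \<open>By \<open>m2\<close> the constant terms of the tangents add up to half of
    \<open>sum t V * m\<close>, so 3/2 - 1/2 = 1 copy remains.\<close>
  have "sum t V * m = 3 / 2 * m * sum t V - (card V * m\<^sup>2) * m / 2"
    by (simp add: m2)
  also have "\<dots> = (\<Sum>v\<in>V. 3 / 2 * m * t v - m ^ 3 / 2)"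
    by (simp add: sum_subtractf sum_distrib_left power2_eq_square power3_eq_cube)
  also have "\<dots> \<le> (\<Sum>v\<in>V. t v * sqrt (t v))"
    by (rule sum_mono) (rule tangent)
  finally show ?thesis
    by (simp add: m_def)
qed

text \<open>The normalisations agree: dividing \<open>S * sqrt (S / n)\<close> by n^4 gives exactly
  the power 3/2 of S / n^3.\<close>

lemma three_halves_dominates:
  assumes H: "triangle_with_pendant_edge H" and K: "complete_digraph 3 (with_proj K)"
  shows "3 / 2 \<in> dominating_exponents H K"
  unfolding dominating_exponents_def
proof (intro CollectI allI impI, elim conjE)
  fix T :: "nat pair_pre_digraph"
  assume T: "pair_graph T" and ne: "pverts T \<noteq> {}"
  interpret T: pair_graph T by fact
  obtain a b c where abc: "distinct [a, b, c]" "pverts K = {a, b, c}"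
    "parcs K = {(a, b), (b, c), (c, a)} \<union> {(a, b), (b, c), (c, a)}\<inverse>"
    using complete_digraph_3_triangle[OF K] .
  have cH: "card (pverts H) = 4"
    using H by (auto simp: triangle_with_pendant_edge_def)
  have cK: "card (pverts K) = 3"
    using abc by simp
  define n where "n = real (card (pverts T))"
  define t where "t v = real (card (triangles_at T v))" for v
  define S where "S = sum t (pverts T)"
  have n: "n > 0"
    using ne T.pair_finite_verts by (simp add: n_def card_gt_0_iff)
  have S: "S \<ge> 0"
    by (simp add: S_def t_def sum_nonneg)
  have "S * sqrt (S / n) \<le> (\<Sum>v\<in>pverts T. t v * sqrt (t v))"
    unfolding S_def n_def
    by (rule sum_mult_sqrt_ge) (simp_all add: ne T.pair_finite_verts t_def)
  also have "\<dots> \<le> (\<Sum>v\<in>pverts T. t v * card (nbrs T v))"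
  proof (rule sum_mono, rule mult_left_mono)
    fix v
    have "t v \<le> (real (card (nbrs T v)))\<^sup>2"
      using T.card_triangles_at_le[of v] by (simp add: t_def flip: of_nat_power)
    then show "sqrt (t v) \<le> card (nbrs T v)"
      by (simp add: real_le_lsqrt t_def)
  qed (simp add: t_def)
  also have "\<dots> = hom_count H T"
    by (simp add: hom_count_triangle_with_pendant_edge[OF T H] t_def)
  finally have main: "S * sqrt (S / n) \<le> hom_count H T" .
  have dK: "hom_density K T = S / n ^ 3"
    by (simp add: hom_density_def cK n_def S_def t_def hom_count_triangle[OF T abc])
  \<comment> \<open>This form includes x = 0, so triangle-free targets need no separate
    case.\<close>
  have "x powr (3 / 2) = x * sqrt x" if "x \<ge> 0" for x :: real
    using powr_add[of x 1 "1 / 2"] that by (simp add: powr_half_sqrt)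
  then have "hom_density K T powr (3 / 2) = S / n ^ 3 * sqrt (S / n ^ 3)"
    using S n by (simp add: dK)
  also have "sqrt (S / n ^ 3) = sqrt (S / n) / n"
    using n by (simp add: real_sqrt_divide power3_eq_cube real_sqrt_mult)
  also have "S / n ^ 3 * (sqrt (S / n) / n) = S * sqrt (S / n) / n ^ 4"
    by (simp add: power3_eq_cube power4_eq_xxxx)
  also have "\<dots> \<le> hom_count H T / n ^ 4"
    using main n by (simp add: divide_right_mono)
  also have "\<dots> = hom_density H T"
    by (simp add: hom_density_def cH n_def)
  finally show "hom_density K T powr (3 / 2) \<le> hom_density H T" .
qed

text \<open>Two components are used because for a single clique both densities tend to 1, and the
  limit would say nothing about the exponent.\<close>

definition two_cliques :: "nat \<Rightarrow> nat pair_pre_digraph" where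
  "two_cliques m = \<lparr>pverts = {..<2 * m},
     parcs = {(u, v). u < 2 * m \<and> v < 2 * m \<and> u \<noteq> v \<and> (u < m \<longleftrightarrow> v < m)}\<rparr>"

lemma pair_graph_two_cliques: "pair_graph (two_cliques m)"
proof -
  have "finite (parcs (two_cliques m))"
    by (rule finite_subset[of _ "{..<2 * m} \<times> {..<2 * m}"]) (auto simp: two_cliques_def)
  moreover have "symmetric (with_proj (two_cliques m))"
    by (auto simp: symmetric_def two_cliques_def sym_def)
  ultimately show ?thesis
    by unfold_locales (auto simp: two_cliques_def)
qed

lemma card_nbrs_two_cliques:
  assumes "v < 2 * m"
  shows "card (nbrs (two_cliques m) v) = m - 1"
proof -
  have "nbrs (two_cliques m) v = (if v < m then {..<m} else {m..<2 * m}) - {v}"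
    using assms by (auto simp: nbrs_def two_cliques_def)
  then show ?thesis
    using assms by simp
qed

text \<open>Any two distinct neighbours of \<open>v\<close> lie in the same clique and are therefore
  adjacent.\<close>

lemma card_triangles_at_two_cliques:
  assumes "v < 2 * m"
  shows "card (triangles_at (two_cliques m) v) = (m - 1) * (m - 2)"
proof -
  let ?N = "nbrs (two_cliques m) v"
  interpret pair_graph "two_cliques m" by (rule pair_graph_two_cliques)
  have "triangles_at (two_cliques m) v = (SIGMA x:?N. ?N - {x})"
    by (auto simp: triangles_at_def nbrs_def two_cliques_def)
  then show ?thesis
    by (simp add: card_nbrs_two_cliques[OF assms] numeral_2_eq_2)
qed

lemma dominating_exponent_ge_three_halves:
  assumes H: "triangle_with_pendant_edge H" and K: "complete_digraph 3 (with_proj K)"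
    and c: "c \<in> dominating_exponents H K"
  shows "3 / 2 \<le> c"
proof -
  obtain x y z where xyz: "distinct [x, y, z]" "pverts K = {x, y, z}"
    "parcs K = {(x, y), (y, z), (z, x)} \<union> {(x, y), (y, z), (z, x)}\<inverse>"
    using complete_digraph_3_triangle[OF K] .
  have cH: "card (pverts H) = 4"
    using H by (auto simp: triangle_with_pendant_edge_def)
  have cK: "card (pverts K) = 3"
    using xyz by simp
  define q where "q m = (real m - 1) * (real m - 2) / (4 * real m ^ 2)" for m :: nat
  have bound: "q m powr c \<le> 1 / 8" if "m \<ge> 2" for m
  proof -
    let ?T = "two_cliques m"
    have V: "pverts ?T = {..<2 * m}"
      by (simp add: two_cliques_def)
    have "hom_count K ?T = 2 * m * ((m - 1) * (m - 2))"
      by (simp add: hom_count_triangle[OF pair_graph_two_cliques xyz] V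
          card_triangles_at_two_cliques)
    then have "hom_density K ?T = q m"
      using that by (simp add: hom_density_def cK V q_def of_nat_diff field_simps
          power2_eq_square power3_eq_cube)
    moreover have "hom_count H ?T = 2 * m * ((m - 1) * (m - 2) * (m - 1))"
      by (simp add: hom_count_triangle_with_pendant_edge[OF pair_graph_two_cliques H] V
          card_triangles_at_two_cliques card_nbrs_two_cliques)
    \<comment> \<open>Replacing every factor by \<open>m\<close> costs nothing in the limit and
      gives 2 m^4 / (2 m)^4 = 1/8 for every \<open>m\<close>.\<close>
    then have "hom_count H ?T \<le> 2 * m * (m * m * m)"
      by (simp add: mult_le_mono)
    then have "real (hom_count H ?T) \<le> real (2 * m * (m * m * m))"
      by (rule of_nat_mono)
    then have "hom_density H ?T \<le> 1 / 8"
      using that by (simp add: hom_density_def cH V field_simps power4_eq_xxxx)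
    moreover have "hom_density K ?T powr c \<le> hom_density H ?T"
      using c pair_graph_two_cliques that
      by (auto simp: dominating_exponents_def V lessThan_empty_iff)
    ultimately show ?thesis by simp
  qed
  have "q \<longlonglongrightarrow> 1 / 4"
    unfolding q_def by real_asymp
  \<comment> \<open>As the limit 1/4 is nonzero, this holds for every real \<open>c\<close>,
    negative ones included.\<close>
  then have "(\<lambda>m. q m powr c) \<longlonglongrightarrow> (1 / 4) powr c"
    by (intro tendsto_intros) simp_all
  then have "(1 / 4) powr c \<le> (1 / 8 :: real)"
    by (rule LIMSEQ_le_const2) (use bound in blast)
  also have "(1 / 8 :: real) = (1 / 4) powr (3 / 2)"
    using powr_add[of "1 / 4 :: real" 1 "1 / 2"] by (simp add: powr_half_sqrt real_sqrt_divide)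
  \<comment> \<open>The base is below 1, so c < 3/2 would reverse the inequality strictly.\<close>
  finally show ?thesis
    using powr_less_mono'[of "1 / 4 :: real" c "3 / 2"] by fastforce
qed

text \<open>\<open>LEAST\<close> over the reals is informative only if a minimum exists, so
  membership and minimality accompany the value.\<close>

theorem theorem5p4:
  fixes H :: "'a pair_pre_digraph" and K :: "'b pair_pre_digraph"
  assumes "triangle_with_pendant_edge H"
    and "complete_digraph 3 (with_proj K)"
  shows "domination_exponent H K = 3 / 2 \<and>
    3 / 2 \<in> dominating_exponents H K \<and> (\<forall>c \<in> dominating_exponents H K. 3 / 2 \<le> c)"
proof -
  note dom = three_halves_dominates[OF assms]
  note ge = dominating_exponent_ge_three_halves[OF assms]
  have "domination_exponent H K = 3 / 2"
    unfolding domination_exponent_def by (rule Least_equality) (fact dom, fact ge)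
  with dom ge show ?thesis by blast
qed

end
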